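(* If $1\leq p\leq q<\infty$, then $\mathcal{L}(\ell_p;\ell_q)\setminus\mathcal{NA}(\ell_p;\ell_q)$ is lineable in $\mathcal{L}(\ell_p;\ell_q)$.
   Context: $\ell_p$ denotes the usual Banach space of $p$-summable scalar sequences indexed by $\mathbb{N}$. $\mathcal{L}(\ell_p;\ell_q)$ is the space of all bounded linear operators from $\ell_p$ to $\ell_q$ with the operator norm $\|T\|=\sup\{\|T(x)\|_{\ell_q}:\|x\|_{\ell_p}=1\}$. $\mathcal{NA}(\ell_p;\ell_q)$ is the subset of norm-attaining operators, i.e. those $T$ for which there is $v\in\ell_p$ with $\|v\|_{\ell_p}=1$ and $\|T(v)\|_{\ell_q}=\|T\|$. A subset $A$ of an infinite-dimensional vector space $V$ is lineable (in $V$) if $A\cup\{0\}$ contains an infinite-dimensional linear subspace of $V$. *)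

theory Defs
  imports "HOL-Analysis.Analysis" "HOL-Library.Function_Algebras"
begin

definition lp_space :: "real \<Rightarrow> (nat \<Rightarrow> 'k::real_normed_field) set"
  where "lp_space p = {x. summable (\<lambda>n. norm (x n) powr p)}"

definition lp_norm :: "real \<Rightarrow> (nat \<Rightarrow> 'k::real_normed_field) \<Rightarrow> real"
  where "lp_norm p x = (\<Sum>n. norm (x n) powr p) powr (1 / p)"

(* Operators are functions on all scalar sequences. The value outside lp_space p is
   fixed to 0, so that each operator on lp_space p is represented by exactly one function and
   the pointwise operations on functions restrict to the usual ones on operators. *)
definition bounded_operators ::
    "real \<Rightarrow> real \<Rightarrow> ((nat \<Rightarrow> 'k::real_normed_field) \<Rightarrow> (nat \<Rightarrow> 'k)) set"
  where "bounded_operators p q =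
    {T. (\<forall>x\<in>lp_space p. T x \<in> lp_space q) \<and>
        (\<forall>x. x \<notin> lp_space p \<longrightarrow> T x = (\<lambda>n. 0)) \<and>
        (\<forall>x\<in>lp_space p. \<forall>y\<in>lp_space p. T (\<lambda>n. x n + y n) = (\<lambda>n. T x n + T y n)) \<and>
        (\<forall>c. \<forall>x\<in>lp_space p. T (\<lambda>n. c * x n) = (\<lambda>n. c * T x n)) \<and>
        (\<exists>C. \<forall>x\<in>lp_space p. lp_norm q (T x) \<le> C * lp_norm p x)}"

definition operator_norm ::
    "real \<Rightarrow> real \<Rightarrow> ((nat \<Rightarrow> 'k::real_normed_field) \<Rightarrow> (nat \<Rightarrow> 'k)) \<Rightarrow> real"
  where "operator_norm p q T = Sup {lp_norm q (T x) | x. x \<in> lp_space p \<and> lp_norm p x = 1}"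

definition norm_attaining ::
    "real \<Rightarrow> real \<Rightarrow> ((nat \<Rightarrow> 'k::real_normed_field) \<Rightarrow> (nat \<Rightarrow> 'k)) set"
  where "norm_attaining p q =
    {T \<in> bounded_operators p q.
       \<exists>v\<in>lp_space p. lp_norm p v = 1 \<and> lp_norm q (T v) = operator_norm p q T}"

definition operator_scale ::
    "'k::real_normed_field \<Rightarrow> ((nat \<Rightarrow> 'k) \<Rightarrow> (nat \<Rightarrow> 'k)) \<Rightarrow> ((nat \<Rightarrow> 'k) \<Rightarrow> (nat \<Rightarrow> 'k))"
  where "operator_scale c T = (\<lambda>x n. c * T x n)"

definition infinite_dimensional :: "('k::field \<Rightarrow> 'v::ab_group_add \<Rightarrow> 'v) \<Rightarrow> 'v set \<Rightarrow> bool"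
  where "infinite_dimensional smul W \<longleftrightarrow> \<not> (\<exists>B. finite B \<and> module.span smul B = W)"

(* V is the carrier of a linear subspace of the ambient vector space 'v with scalar
   multiplication smul. *)
definition lineable_in ::
    "('k::field \<Rightarrow> 'v::ab_group_add \<Rightarrow> 'v) \<Rightarrow> 'v set \<Rightarrow> 'v set \<Rightarrow> bool"
  where "lineable_in smul V A \<longleftrightarrow>
    (\<exists>W. module.subspace smul W \<and> W \<subseteq> V \<and> infinite_dimensional smul W \<and> W \<subseteq> A \<union> {0})"

lemma vector_space_operator_scale: "vector_space operator_scale"
  by unfold_locales (simp_all add: operator_scale_def fun_eq_iff distrib_left distrib_right mult.assoc)

lemma norm_add_powr_le:
  fixes a b :: "'k::real_normed_field"
  assumes "0 \<le> p"
  shows "norm (a + b) powr p \<le> 2 powr p * (norm a powr p + norm b powr p)"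
proof -
  have "norm (a + b) \<le> 2 * max (norm a) (norm b)"
    using norm_triangle_ineq[of a b] by linarith
  then have "norm (a + b) powr p \<le> (2 * max (norm a) (norm b)) powr p"
    using assms by (intro powr_mono2) auto
  also have "\<dots> = 2 powr p * max (norm a) (norm b) powr p"
    by (simp add: powr_mult)
  also have "\<dots> \<le> 2 powr p * (norm a powr p + norm b powr p)"
    by (intro mult_left_mono) (auto simp: max_def)
  finally show ?thesis .
qed

lemma lp_space_add:
  assumes "0 \<le> p" "x \<in> lp_space p" "y \<in> lp_space p"
  shows "(\<lambda>n. x n + y n) \<in> lp_space p"
proof -
  have "summable (\<lambda>n. 2 powr p * (norm (x n) powr p + norm (y n) powr p))"
    using assms by (intro summable_mult summable_add) (auto simp: lp_space_def)
  then have "summable (\<lambda>n. norm (x n + y n) powr p)"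
    by (rule summable_comparison_test'[where N = 0]) (simp add: norm_add_powr_le assms(1))
  then show ?thesis
    by (simp add: lp_space_def)
qed

lemma lp_space_scale: "x \<in> lp_space p \<Longrightarrow> (\<lambda>n. c * x n) \<in> lp_space p"
  by (auto simp: lp_space_def norm_mult powr_mult intro: summable_mult)

lemma lp_norm_scale:
  assumes "0 < p" "x \<in> lp_space p"
  shows "lp_norm p (\<lambda>n. c * x n) = norm c * lp_norm p x"
  using assms
  by (simp add: lp_norm_def lp_space_def norm_mult powr_mult suminf_mult powr_powr suminf_nonneg)

lemma lp_norm_nonneg: "0 \<le> lp_norm p x"
  by (simp add: lp_norm_def)

lemma lp_norm_powr:
  assumes "0 < p" "x \<in> lp_space p"
  shows "lp_norm p x powr p = (\<Sum>n. norm (x n) powr p)"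
  using assms by (simp add: lp_norm_def lp_space_def powr_powr suminf_nonneg)

lemma lp_norm_add_le:
  assumes p: "0 < p" and x: "x \<in> lp_space p" and y: "y \<in> lp_space p"
  shows "lp_norm p (\<lambda>n. x n + y n) \<le> 2 * 2 powr (1 / p) * (lp_norm p x + lp_norm p y)"
proof -
  define m where "m = max (lp_norm p x) (lp_norm p y)"
  have m: "0 \<le> m" by (simp add: m_def lp_norm_nonneg max.coboundedI1)
  have sx: "summable (\<lambda>n. norm (x n) powr p)" and sy: "summable (\<lambda>n. norm (y n) powr p)"
    using x y by (auto simp: lp_space_def)
  have "(\<Sum>n. norm (x n + y n) powr p) \<le> (\<Sum>n. 2 powr p * (norm (x n) powr p + norm (y n) powr p))"
    using p lp_space_add[OF _ x y] sx sy
    by (intro suminf_le norm_add_powr_le summable_mult summable_add) (auto simp: lp_space_def)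
  also have "\<dots> = 2 powr p * (lp_norm p x powr p + lp_norm p y powr p)"
    using sx sy by (simp add: suminf_mult summable_add suminf_add lp_norm_powr p x y)
  also have "\<dots> \<le> 2 powr p * (m powr p + m powr p)"
    using p by (intro mult_left_mono add_mono powr_mono2) (auto simp: m_def lp_norm_nonneg)
  also have "\<dots> = 2 powr p * 2 * m powr p" by simp
  finally have "lp_norm p (\<lambda>n. x n + y n) \<le> (2 powr p * 2 * m powr p) powr (1 / p)"
    unfolding lp_norm_def using p lp_space_add[OF _ x y]
    by (intro powr_mono2) (auto simp: lp_space_def intro!: suminf_nonneg)
  also have "\<dots> = 2 * 2 powr (1 / p) * m"
    using p m by (simp add: powr_mult powr_powr)
  also have "\<dots> \<le> 2 * 2 powr (1 / p) * (lp_norm p x + lp_norm p y)"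
    by (intro mult_left_mono) (auto simp: m_def lp_norm_nonneg)
  finally show ?thesis .
qed

lemma bounded_operatorsD:
  assumes "T \<in> bounded_operators p q"
  shows "x \<in> lp_space p \<Longrightarrow> T x \<in> lp_space q"
    and "x \<notin> lp_space p \<Longrightarrow> T x = (\<lambda>n. 0)"
    and "x \<in> lp_space p \<Longrightarrow> y \<in> lp_space p \<Longrightarrow> T (\<lambda>n. x n + y n) = (\<lambda>n. T x n + T y n)"
    and "x \<in> lp_space p \<Longrightarrow> T (\<lambda>n. c * x n) = (\<lambda>n. c * T x n)"
    and "\<exists>C. \<forall>x\<in>lp_space p. lp_norm q (T x) \<le> C * lp_norm p x"
  using assms by (simp_all add: bounded_operators_def)

lemma subspace_bounded_operators:
  assumes q: "1 \<le> q"
  shows "module.subspace operator_scale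
    (bounded_operators p q :: ((nat \<Rightarrow> 'k::real_normed_field) \<Rightarrow> (nat \<Rightarrow> 'k)) set)"
proof -
  interpret vector_space "operator_scale :: 'k \<Rightarrow> ((nat \<Rightarrow> 'k) \<Rightarrow> (nat \<Rightarrow> 'k)) \<Rightarrow> _"
    by (rule vector_space_operator_scale)
  show ?thesis
  proof (rule subspaceI)
    have "(\<lambda>x n. 0) \<in> (bounded_operators p q :: ((nat \<Rightarrow> 'k) \<Rightarrow> (nat \<Rightarrow> 'k)) set)"
      unfolding bounded_operators_def
      by (simp add: lp_space_def lp_norm_def) (rule exI[of _ 0], simp)
    then show "0 \<in> (bounded_operators p q :: ((nat \<Rightarrow> 'k) \<Rightarrow> (nat \<Rightarrow> 'k)) set)"
      by (simp add: zero_fun_def)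
  next
    fix S T :: "(nat \<Rightarrow> 'k) \<Rightarrow> (nat \<Rightarrow> 'k)"
    assume S: "S \<in> bounded_operators p q" and T: "T \<in> bounded_operators p q"
    note Sd = bounded_operatorsD[OF S] and Td = bounded_operatorsD[OF T]
    obtain C where C: "\<And>x. x \<in> lp_space p \<Longrightarrow> lp_norm q (S x) \<le> C * lp_norm p x"
      using Sd(5) by blast
    obtain D where D: "\<And>x. x \<in> lp_space p \<Longrightarrow> lp_norm q (T x) \<le> D * lp_norm p x"
      using Td(5) by blast
    have "lp_norm q (\<lambda>n. S x n + T x n) \<le> (2 * 2 powr (1 / q) * (C + D)) * lp_norm p x"
      if x: "x \<in> lp_space p" for x
    proof -
      have "lp_norm q (\<lambda>n. S x n + T x n)
          \<le> 2 * 2 powr (1 / q) * (lp_norm q (S x) + lp_norm q (T x))"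
        using q by (intro lp_norm_add_le Sd(1) Td(1) x) simp
      also have "\<dots> \<le> 2 * 2 powr (1 / q) * (C * lp_norm p x + D * lp_norm p x)"
        by (intro mult_left_mono add_mono C D x) simp
      finally show ?thesis by (simp add: distrib_right mult.assoc)
    qed
    then have "\<exists>E. \<forall>x\<in>lp_space p. lp_norm q (\<lambda>n. S x n + T x n) \<le> E * lp_norm p x" by blast
    moreover have "(\<lambda>n. S x n + T x n) \<in> lp_space q" if "x \<in> lp_space p" for x
      using q that by (intro lp_space_add Sd(1) Td(1)) simp_all
    ultimately show "S + T \<in> bounded_operators p q"
      unfolding bounded_operators_def plus_fun_def
      by (simp add: Sd(2-4) Td(2-4) add_ac distrib_left)
  next
    fix c and T :: "(nat \<Rightarrow> 'k) \<Rightarrow> (nat \<Rightarrow> 'k)"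
    assume T: "T \<in> bounded_operators p q"
    note Td = bounded_operatorsD[OF T]
    obtain D where D: "\<And>x. x \<in> lp_space p \<Longrightarrow> lp_norm q (T x) \<le> D * lp_norm p x"
      using Td(5) by blast
    have "lp_norm q (\<lambda>n. c * T x n) \<le> (norm c * D) * lp_norm p x" if x: "x \<in> lp_space p" for x
    proof -
      have "lp_norm q (\<lambda>n. c * T x n) = norm c * lp_norm q (T x)"
        using q by (intro lp_norm_scale Td(1) x) simp
      also have "\<dots> \<le> norm c * (D * lp_norm p x)"
        by (intro mult_left_mono D x norm_ge_zero)
      finally show ?thesis by (simp only: mult.assoc)
    qed
    then have "\<exists>E. \<forall>x\<in>lp_space p. lp_norm q (\<lambda>n. c * T x n) \<le> E * lp_norm p x" by blast
    moreover have "(\<lambda>n. c * T x n) \<in> lp_space q" if "x \<in> lp_space p" for x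
      by (intro lp_space_scale Td(1) that)
    ultimately show "operator_scale c T \<in> bounded_operators p q"
      unfolding bounded_operators_def operator_scale_def
      by (simp add: Td(2-4) mult.left_commute distrib_left)
  qed
qed

end

(* The diagonal operator x |-> ((1 - 1/(n+2)) x_n) does not attain its norm: it strictly decreases
   the q-norm of every nonzero sequence, the q-norm is at most the p-norm, and the unit vectors show
   that the operator norm is 1. Splitting the index set into countably many infinite pieces, let
   "copies p c" put c_k times this operator into the k-th piece. Its value at x has q-norm equal to
   the q-norm of c times that of the shrunk x, so no nonzero c gives a norm-attaining operator,
   while the map from c to "copies p c" is linear and injective. *)
theory Submission
  imports Defs
begin

section \<open>The operators built from copies of one diagonal operator\<close>

text \<open>The elementary tensor of \<open>c\<close> and \<open>y\<close>, a double sequence, is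
  flattened by the pairing bijection. The k-th infinite piece of the index set consists of the
  \<open>m\<close> with \<open>fst (prod_decode m) = k\<close>.\<close>

definition tensor :: "(nat \<Rightarrow> 'k) \<Rightarrow> (nat \<Rightarrow> 'k) \<Rightarrow> nat \<Rightarrow> 'k::real_normed_field"
  where "tensor c y = (\<lambda>m. c (fst (prod_decode m)) * y (snd (prod_decode m)))"

text \<open>The factors lie strictly below 1 and tend to 1. The shift by 2 makes the factor at index
  0 equal to 1/2 instead of 0, so no coordinate is killed.\<close>

definition shrink :: "(nat \<Rightarrow> 'k::real_normed_field) \<Rightarrow> nat \<Rightarrow> 'k"
  where "shrink x = (\<lambda>n. of_real (1 - 1 / (real n + 2)) * x n)"

definition copies :: "real \<Rightarrow> (nat \<Rightarrow> 'k::real_normed_field) \<Rightarrow> (nat \<Rightarrow> 'k) \<Rightarrow> nat \<Rightarrow> 'k"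
  where "copies p c x = (if x \<in> lp_space p then tensor c (shrink x) else (\<lambda>n. 0))"

lemma shrink_add: "shrink (\<lambda>n. x n + y n) = (\<lambda>n. shrink x n + shrink y n)"
  by (simp add: shrink_def distrib_left)

lemma shrink_scale: "shrink (\<lambda>n. a * x n) = (\<lambda>n. a * shrink x n)"
  by (simp add: shrink_def mult_ac)

lemma tensor_add: "tensor c (\<lambda>n. x n + y n) = (\<lambda>n. tensor c x n + tensor c y n)"
  by (simp add: tensor_def distrib_left)

lemma tensor_scale: "tensor c (\<lambda>n. a * x n) = (\<lambda>n. a * tensor c x n)"
  by (simp add: tensor_def mult_ac)

section \<open>Multiplicativity of the norm on tensors\<close>

text \<open>Fubini for nonnegative terms: the double family is summed first over \<open>n\<close>,
  then over \<open>k\<close>, and unconditional convergence allows reindexing by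
  \<open>prod_decode\<close>.\<close>

lemma sums_prod_decode:
  fixes f g :: "nat \<Rightarrow> real"
  assumes f: "summable f" "\<And>n. 0 \<le> f n" and g: "summable g" "\<And>n. 0 \<le> g n"
  shows "(\<lambda>m. f (fst (prod_decode m)) * g (snd (prod_decode m))) sums (suminf f * suminf g)"
proof -
  have inner: "((\<lambda>n. f k * g n) has_sum f k * suminf g) UNIV" for k
    by (intro has_sum_cmult_right sums_nonneg_imp_has_sum summable_sums g)
  have outer: "((\<lambda>k. f k * suminf g) has_sum suminf f * suminf g) UNIV"
    by (intro has_sum_cmult_left sums_nonneg_imp_has_sum summable_sums f)
  \<comment> \<open>Summability over the product has to be known before the iterated sum can be
    identified with the double sum; nonnegativity supplies it.\<close>
  have "(\<lambda>(k, n). f k * g n) summable_on (UNIV \<times> UNIV)"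
    using inner outer f(2) g(2)
    by (intro summable_on_SigmaI[where g = "\<lambda>k. f k * suminf g"]) (auto simp: summable_on_def)
  then have "((\<lambda>(k, n). f k * g n) has_sum suminf f * suminf g) (UNIV \<times> UNIV)"
    using inner outer by (intro has_sum_SigmaI[where g = "\<lambda>k. f k * suminf g"]) auto
  then have "((\<lambda>m. f (fst (prod_decode m)) * g (snd (prod_decode m))) has_sum suminf f * suminf g) UNIV"
    using has_sum_reindex_bij_betw[OF bij_prod_decode, of "\<lambda>(k, n). f k * g n"]
    by (simp add: case_prod_beta)
  then show ?thesis by (rule has_sum_imp_sums)
qed

lemma
  fixes c y :: "nat \<Rightarrow> 'k::real_normed_field"
  assumes "0 < q" and c: "c \<in> lp_space q" and y: "y \<in> lp_space q"
  shows tensor_in_lp_space: "tensor c y \<in> lp_space q"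
    and lp_norm_tensor: "lp_norm q (tensor c y) = lp_norm q c * lp_norm q y"
proof -
  have sums: "(\<lambda>m. norm (tensor c y m) powr q) sums
      ((\<Sum>n. norm (c n) powr q) * (\<Sum>n. norm (y n) powr q))"
    using sums_prod_decode[of "\<lambda>n. norm (c n) powr q" "\<lambda>n. norm (y n) powr q"] c y
    by (simp add: lp_space_def tensor_def norm_mult powr_mult)
  then show "tensor c y \<in> lp_space q"
    by (auto simp: lp_space_def sums_iff)
  show "lp_norm q (tensor c y) = lp_norm q c * lp_norm q y"
    using sums c y by (simp add: lp_norm_def lp_space_def sums_iff powr_mult suminf_nonneg)
qed

section \<open>Comparison of the p-norm and the q-norm\<close>

lemma norm_le_lp_norm:
  assumes "0 < p" "x \<in> lp_space p"
  shows "norm (x n) \<le> lp_norm p x"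
proof -
  have "norm (x n) powr p \<le> (\<Sum>n. norm (x n) powr p)"
    using sum_le_suminf[of "\<lambda>n. norm (x n) powr p" "{n}"] assms(2) by (simp add: lp_space_def)
  then have "(norm (x n) powr p) powr (1 / p) \<le> lp_norm p x"
    unfolding lp_norm_def using assms(1) by (intro powr_mono2) auto
  then show ?thesis using assms(1) by (simp add: powr_powr)
qed

text \<open>Every entry is at most \<open>L\<close>, the p-norm, so its q-th power is at most its
  p-th power times \<open>L powr (q - p)\<close>. Summation bounds the q-th power of the q-norm by
  \<open>L powr q\<close>.\<close>

lemma
  assumes pq: "0 < p" "p \<le> q" and x: "x \<in> lp_space p"
  shows lp_space_mono: "x \<in> lp_space q"
    and lp_norm_antimono: "lp_norm q x \<le> lp_norm p x"
proof -
  define L where "L = lp_norm p x"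
  have L: "0 \<le> L" by (simp add: L_def lp_norm_nonneg)
  have le: "norm (x n) powr q \<le> norm (x n) powr p * L powr (q - p)" for n
  proof -
    have "norm (x n) powr q = norm (x n) powr p * norm (x n) powr (q - p)"
      by (simp add: powr_add[symmetric])
    also have "\<dots> \<le> norm (x n) powr p * L powr (q - p)"
      using pq norm_le_lp_norm[OF pq(1) x] by (intro mult_left_mono powr_mono2) (auto simp: L_def)
    finally show ?thesis .
  qed
  have sp: "summable (\<lambda>n. norm (x n) powr p)" using x by (simp add: lp_space_def)
  have s: "summable (\<lambda>n. norm (x n) powr q)"
    by (rule summable_comparison_test'[OF summable_mult2[OF sp, of "L powr (q - p)"], where N = 0]) (simp add: le)
  then show xq: "x \<in> lp_space q" by (simp add: lp_space_def)
  have "lp_norm q x powr q = (\<Sum>n. norm (x n) powr q)"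
    using pq xq by (simp add: lp_norm_powr)
  also have "\<dots> \<le> (\<Sum>n. norm (x n) powr p * L powr (q - p))"
    by (intro suminf_le s summable_mult2 sp le)
  also have "\<dots> = L powr p * L powr (q - p)"
    using pq x sp by (simp add: suminf_mult2[symmetric] lp_norm_powr L_def)
  also have "\<dots> = L powr q" by (simp add: powr_add[symmetric])
  finally show "lp_norm q x \<le> lp_norm p x"
    using powr_less_mono2[of q L "lp_norm q x"] pq L by (fastforce simp: L_def)
qed

section \<open>The diagonal operator\<close>

lemma norm_shrink: "norm (shrink x n) = (1 - 1 / (real n + 2)) * norm (x n)"
  by (simp add: shrink_def norm_mult del: of_real_diff)

lemma norm_shrink_le: "norm (shrink x n) \<le> norm (x n)"
  unfolding norm_shrink by (rule mult_left_le_one_le) (auto simp: field_simps)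

lemma shrink_in_lp_space:
  assumes "0 < q" "x \<in> lp_space q"
  shows "shrink x \<in> lp_space q"
  using assms unfolding lp_space_def
  by (auto intro!: summable_comparison_test'[where N = 0 and g = "\<lambda>n. norm (x n) powr q"]
        powr_mono2 norm_shrink_le)

text \<open>No term of the series grows, and the term at a nonzero entry strictly decreases, so the
  series of differences has a positive sum.\<close>

lemma lp_norm_shrink_less:
  assumes q: "0 < q" and x: "x \<in> lp_space q" and ne: "x \<noteq> (\<lambda>n. 0)"
  shows "lp_norm q (shrink x) < lp_norm q x"
proof -
  obtain k where k: "x k \<noteq> 0" using ne by auto
  let ?d = "\<lambda>n. norm (x n) powr q - norm (shrink x n) powr q"
  have s: "summable (\<lambda>n. norm (x n) powr q)" "summable (\<lambda>n. norm (shrink x n) powr q)"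
    using x shrink_in_lp_space[OF q x] by (auto simp: lp_space_def)
  have "norm (shrink x k) < norm (x k)"
    using k by (simp add: norm_shrink field_simps)
  then have "0 < suminf ?d"
    using q by (intro suminf_pos2[where i = k] summable_diff s)
      (auto intro: powr_mono2 powr_less_mono2 norm_shrink_le)
  then have "(\<Sum>n. norm (shrink x n) powr q) < (\<Sum>n. norm (x n) powr q)"
    by (simp add: suminf_diff[symmetric] s)
  then show ?thesis
    using q s by (simp add: lp_norm_def powr_less_mono2 suminf_nonneg)
qed

lemma lp_norm_shrink_le:
  assumes q: "0 < q" and x: "x \<in> lp_space q"
  shows "lp_norm q (shrink x) \<le> lp_norm q x"
proof (cases "x = (\<lambda>n. 0)")
  case True
  then show ?thesis by (simp add: shrink_def)
next
  case False
  then show ?thesis using lp_norm_shrink_less[OF q x] by simp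
qed

section \<open>Finitely supported sequences and positivity of the norm\<close>

lemma finite_support_in_lp_space:
  assumes "finite {n. c n \<noteq> 0}"
  shows "c \<in> lp_space q"
  unfolding lp_space_def mem_Collect_eq by (rule summable_finite[OF assms]) simp

lemma lp_norm_single:
  assumes "0 < q"
  shows "lp_norm q (\<lambda>n. if n = k then a else 0) = norm a"
proof -
  have "(\<Sum>n. norm (if n = k then a else 0) powr q) = norm a powr q"
    using suminf_finite[of "{k}" "\<lambda>n. norm (if n = k then a else 0) powr q"] by simp
  then show ?thesis using assms by (simp add: lp_norm_def powr_powr)
qed

text \<open>The norm strictly exceeds that of the shrunk sequence, which is nonnegative.\<close>

lemma lp_norm_pos:
  assumes "0 < q" "x \<in> lp_space q" "x \<noteq> (\<lambda>n. 0)"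
  shows "0 < lp_norm q x"
  using lp_norm_shrink_less[OF assms] lp_norm_nonneg[of q "shrink x"] by linarith

section \<open>Boundedness and failure to attain the norm\<close>

lemma lp_norm_copies:
  assumes "0 < p" "p \<le> q" "c \<in> lp_space q" "x \<in> lp_space p"
  shows "lp_norm q (copies p c x) = lp_norm q c * lp_norm q (shrink x)"
  using assms by (simp add: copies_def lp_norm_tensor shrink_in_lp_space lp_space_mono)

lemma lp_norm_copies_le:
  assumes "0 < p" "p \<le> q" "c \<in> lp_space q" "x \<in> lp_space p"
  shows "lp_norm q (copies p c x) \<le> lp_norm q c * lp_norm p x"
proof -
  have "lp_norm q (shrink x) \<le> lp_norm q x"
    using assms by (intro lp_norm_shrink_le lp_space_mono[of p q]) auto
  also have "\<dots> \<le> lp_norm p x"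
    using assms by (intro lp_norm_antimono)
  finally show ?thesis
    using assms by (simp add: lp_norm_copies mult_left_mono lp_norm_nonneg)
qed

lemma copies_bounded:
  assumes pq: "0 < p" "p \<le> q" and c: "c \<in> lp_space q"
  shows "copies p c \<in> bounded_operators p q"
  unfolding bounded_operators_def
proof (intro CollectI conjI)
  show "\<forall>x\<in>lp_space p. copies p c x \<in> lp_space q"
    using pq by (simp add: copies_def tensor_in_lp_space shrink_in_lp_space lp_space_mono[OF pq] c)
  show "\<exists>C. \<forall>x\<in>lp_space p. lp_norm q (copies p c x) \<le> C * lp_norm p x"
    using lp_norm_copies_le[OF assms] by blast
qed (use pq in \<open>simp_all add: copies_def lp_space_add lp_space_scale tensor_add tensor_scale shrink_add shrink_scale\<close>)

lemma copies_not_norm_attaining: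
  fixes c :: "nat \<Rightarrow> 'k::real_normed_field"
  assumes pq: "0 < p" "p \<le> q" and c: "c \<in> lp_space q" "c \<noteq> (\<lambda>n. 0)"
  shows "copies p c \<notin> norm_attaining p q"
proof
  assume "copies p c \<in> norm_attaining p q"
  then obtain v where v: "v \<in> lp_space p" "lp_norm p v = 1"
    and att: "lp_norm q (copies p c v) = operator_norm p q (copies p c)"
    by (auto simp: norm_attaining_def)
  define C where "C = lp_norm q c"
  have q: "0 < q" using pq by simp
  have C: "0 < C" unfolding C_def by (rule lp_norm_pos[OF q c])
  have vq: "v \<in> lp_space q" using lp_space_mono[OF pq v(1)] .
  have "v \<noteq> (\<lambda>n. 0)" using v(2) pq by (auto simp: lp_norm_def)
  then have "lp_norm q (shrink v) < lp_norm q v" by (rule lp_norm_shrink_less[OF q vq])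
  also have "\<dots> \<le> 1" using lp_norm_antimono[OF pq v(1)] v(2) by simp
  finally have "lp_norm q (copies p c v) < C"
    using C by (simp add: lp_norm_copies[OF pq c(1) v(1)] C_def)
  \<comment> \<open>By \<open>att\<close> the right side is the operator norm, which dominates the
    values at the unit vectors; these tend to \<open>C\<close>.\<close>
  moreover have "C \<le> lp_norm q (copies p c v)"
  proof (rule LIMSEQ_le_const2)
    show "(\<lambda>n. C * (1 - 1 / (real n + 2))) \<longlonglongrightarrow> C"
    proof -
      have "(\<lambda>n. C * (1 - inverse (real (Suc (Suc n))))) \<longlonglongrightarrow> C * (1 - 0)"
        by (intro tendsto_mult tendsto_diff tendsto_const LIMSEQ_Suc[OF LIMSEQ_inverse_real_of_nat])
      moreover have "real (Suc (Suc n)) = real n + 2" for n by simp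
      ultimately show ?thesis by (simp only: inverse_eq_divide diff_zero mult_1_right)
    qed
    have "C * (1 - 1 / (real n + 2)) \<le> operator_norm p q (copies p c)" for n
      unfolding operator_norm_def
    proof (rule cSup_upper)
      let ?e = "\<lambda>m. if m = n then 1 else 0 :: 'k"
      have e: "?e \<in> lp_space p" by (rule finite_support_in_lp_space) simp
      have "shrink ?e = (\<lambda>m. if m = n then of_real (1 - 1 / (real n + 2)) else 0)"
        by (auto simp: shrink_def)
      then have "lp_norm q (copies p c ?e) = C * (1 - 1 / (real n + 2))"
        using q by (simp only: lp_norm_copies[OF pq c(1) e] lp_norm_single norm_of_real) (simp add: C_def)
      moreover have "lp_norm p ?e = 1" using pq by (simp add: lp_norm_single)
      ultimately show "C * (1 - 1 / (real n + 2))
          \<in> {lp_norm q (copies p c x) |x. x \<in> lp_space p \<and> lp_norm p x = 1}"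
        using e by (intro CollectI exI[of _ ?e]) simp
      \<comment> \<open>A real \<open>Sup\<close> is an upper bound only for a set bounded above;
        \<open>C\<close> bounds this one because the p-norm of \<open>x\<close> is 1.\<close>
      show "bdd_above {lp_norm q (copies p c x) |x. x \<in> lp_space p \<and> lp_norm p x = 1}"
        using lp_norm_copies_le[OF pq c(1)] by (intro bdd_aboveI[of _ C]) (force simp: C_def)
    qed
    then show "\<exists>N. \<forall>n\<ge>N. C * (1 - 1 / (real n + 2)) \<le> lp_norm q (copies p c v)"
      by (simp add: att)
  qed
  ultimately show False by simp
qed

section \<open>Linearity, injectivity and infinite dimension\<close>

lemma copies_add: "copies p (\<lambda>n. c n + d n) = copies p c + copies p d"
  by (auto simp: copies_def tensor_def plus_fun_def fun_eq_iff algebra_simps)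

lemma copies_scale: "copies p (\<lambda>n. a * c n) = operator_scale a (copies p c)"
  by (auto simp: copies_def tensor_def operator_scale_def fun_eq_iff)

lemma copies_zero: "copies p (\<lambda>n. 0) = 0"
  by (auto simp: copies_def tensor_def fun_eq_iff)

text \<open>At the unit vector of index 0, the coordinate \<open>prod_encode (k, 0)\<close> of the
  image is half of \<open>c k\<close>, so the operator determines every entry of
  \<open>c\<close>.\<close>

lemma copies_inject:
  assumes "copies p c = copies p d"
  shows "c = d"
proof
  fix k
  let ?e = "\<lambda>m. if m = 0 then 1 else 0 :: 'a"
  have "?e \<in> lp_space p" by (rule finite_support_in_lp_space) simp
  then have "tensor c (shrink ?e) (prod_encode (k, 0)) = tensor d (shrink ?e) (prod_encode (k, 0))"
    using fun_cong[OF assms, of ?e] by (simp add: copies_def)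
  then show "c k = d k" by (simp add: tensor_def shrink_def)
qed

text \<open>The bound \<open>K\<close> on supports serves two uses: \<open>UNIV\<close> gives the
  whole witness space, and a finite \<open>K\<close> confines the span of finitely many
  operators.\<close>

lemma subspace_copies:
  fixes K :: "nat set"
  shows "module.subspace operator_scale (copies p ` {c. finite {n. c n \<noteq> 0} \<and> {n. c n \<noteq> (0::'k::real_normed_field)} \<subseteq> K})"
proof -
  interpret vector_space "operator_scale :: 'k \<Rightarrow> ((nat \<Rightarrow> 'k) \<Rightarrow> (nat \<Rightarrow> 'k)) \<Rightarrow> _"
    by (rule vector_space_operator_scale)
  show ?thesis
  proof (rule subspaceI, goal_cases)
    case 1
    show ?case by (rule image_eqI[where x = "\<lambda>n. 0"]) (simp_all add: copies_zero)
  next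
    case (2 S T)
    then obtain c d where cd: "S = copies p c" "T = copies p d" "finite {n. c n \<noteq> 0}"
      "finite {n. d n \<noteq> 0}" "{n. c n \<noteq> 0} \<subseteq> K" "{n. d n \<noteq> 0} \<subseteq> K" by auto
    have "{n. c n + d n \<noteq> 0} \<subseteq> {n. c n \<noteq> 0} \<union> {n. d n \<noteq> 0}" by auto
    with cd(3-6) have "finite {n. c n + d n \<noteq> 0}" "{n. c n + d n \<noteq> 0} \<subseteq> K"
      by (meson finite_UnI finite_subset, blast)
    with cd(1,2) show ?case by (intro image_eqI[where x = "\<lambda>n. c n + d n"]) (simp_all add: copies_add)
  next
    case (3 a T)
    then obtain c where c: "T = copies p c" "finite {n. c n \<noteq> 0}" "{n. c n \<noteq> 0} \<subseteq> K" by auto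
    have sub: "{n. a * c n \<noteq> 0} \<subseteq> {n. c n \<noteq> 0}" by auto
    show ?case
      using c finite_subset[OF sub] sub
      by (intro image_eqI[where x = "\<lambda>n. a * c n"]) (auto simp: copies_scale)
  qed
qed

text \<open>Finitely many finitely supported sequences have their supports in one finite set
  \<open>K\<close>, and so does every member of their span. A unit vector at an index outside
  \<open>K\<close> then yields an operator that is not spanned.\<close>

lemma infinite_dimensional_copies:
  "infinite_dimensional operator_scale
    (copies p ` {c. finite {n. c n \<noteq> (0::'k::real_normed_field)}})"
  unfolding infinite_dimensional_def
proof (rule notI, elim exE conjE)
  interpret vector_space "operator_scale :: 'k \<Rightarrow> ((nat \<Rightarrow> 'k) \<Rightarrow> (nat \<Rightarrow> 'k)) \<Rightarrow> _"
    by (rule vector_space_operator_scale)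
  let ?F = "{c. finite {n. c n \<noteq> (0::'k)}}"
  fix B assume B: "finite B" "span B = copies p ` ?F"
  then have "B \<subseteq> copies p ` ?F" using span_superset by blast
  then obtain D where D: "D \<subseteq> ?F" "finite D" "B = copies p ` D"
    using finite_subset_image[OF B(1)] by blast
  define K where "K = (\<Union>c\<in>D. {n. c n \<noteq> 0})"
  have "finite K" using D by (auto simp: K_def)
  then obtain k where k: "k \<notin> K" using ex_new_if_finite infinite_UNIV_nat by blast
  have "span B \<subseteq> copies p ` {c. finite {n. c n \<noteq> 0} \<and> {n. c n \<noteq> 0} \<subseteq> K}"
    using D by (intro span_minimal subspace_copies) (auto simp: K_def)
  moreover have "copies p (\<lambda>n. if n = k then 1 else 0) \<in> span B"
    unfolding B(2) by (intro imageI) simp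
  ultimately obtain c where c: "copies p (\<lambda>n. if n = k then 1 else 0 :: 'k) = copies p c" "{n. c n \<noteq> 0} \<subseteq> K"
    by blast
  \<comment> \<open>By injectivity \<open>c\<close> is the unit vector at \<open>k\<close> itself,
    although its support lies in \<open>K\<close>.\<close>
  have "c k \<noteq> 0" using copies_inject[OF c(1), symmetric] by simp
  with c(2) have "k \<in> K" by auto
  with k show False ..
qed

text \<open>The witness space uses finitely supported \<open>c\<close>, which lie in
  \<open>lp_space q\<close>. A general scalar field lets the real and complex cases be instances of
  one proof.\<close>

lemma lineable_not_norm_attaining:
  assumes pq: "0 < p" "p \<le> q"
  shows "lineable_in operator_scale
    (bounded_operators p q :: ((nat \<Rightarrow> 'k::real_normed_field) \<Rightarrow> (nat \<Rightarrow> 'k)) set)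
    (bounded_operators p q - norm_attaining p q)"
proof -
  let ?W = "copies p ` {c. finite {n. c n \<noteq> (0::'k)}}"
  have bounded: "?W \<subseteq> bounded_operators p q"
    using pq by (auto intro: copies_bounded finite_support_in_lp_space)
  moreover have "?W \<subseteq> (bounded_operators p q - norm_attaining p q) \<union> {0}"
  proof
    fix T :: "(nat \<Rightarrow> 'k) \<Rightarrow> nat \<Rightarrow> 'k"
    assume "T \<in> ?W"
    then obtain c where T: "T = copies p c" and c: "finite {n. c n \<noteq> 0}" by auto
    have "copies p c \<notin> norm_attaining p q" if "c \<noteq> (\<lambda>n. 0)"
      using pq finite_support_in_lp_space[OF c] that by (rule copies_not_norm_attaining)
    then show "T \<in> (bounded_operators p q - norm_attaining p q) \<union> {0}"
      using bounded \<open>T \<in> ?W\<close> by (cases "c = (\<lambda>n. 0)") (auto simp: T copies_zero)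
  qed
  moreover have "module.subspace operator_scale ?W"
    using subspace_copies[of p UNIV] by simp
  ultimately show ?thesis
    unfolding lineable_in_def using infinite_dimensional_copies by blast
qed

theorem corollary8:
  fixes p q :: real
  assumes "1 \<le> p" and "p \<le> q"
  shows "lineable_in operator_scale
           (bounded_operators p q :: ((nat \<Rightarrow> real) \<Rightarrow> (nat \<Rightarrow> real)) set)
           (bounded_operators p q - norm_attaining p q)
       \<and> lineable_in operator_scale
           (bounded_operators p q :: ((nat \<Rightarrow> complex) \<Rightarrow> (nat \<Rightarrow> complex)) set)
           (bounded_operators p q - norm_attaining p q)"
  using assms by (intro conjI lineable_not_norm_attaining) auto

end
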